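(* For each $\Sigma_1$-formula $\varphi(x_1,\dots,x_n)$ and all natural numbers $k_1,\dots,k_n$: $\mathbb{N}\models\varphi(k_1,\dots,k_n)$ if and only if $R^\backsim\vdash_{\mathrm{QL}_0}\varphi(\overline{k_1},\dots,\overline{k_n})$.
   Context: Propositional logic $\mathrm{L}_0$: language $\to,\wedge,\vee,\bot$; $\neg\varphi:=\varphi\to\bot$, $\varphi\leftrightarrow\psi:=(\varphi\to\psi)\wedge(\psi\to\varphi)$. Axioms: $\varphi\to\varphi$; $\varphi\wedge\psi\to\varphi$; $\varphi\wedge\psi\to\psi$; $\varphi\to\varphi\vee\psi$; $\psi\to\varphi\vee\psi$. Rules: $\varphi\rhd\psi\to\varphi$; $\varphi,\varphi\to\psi\rhd\psi$; $\varphi\rhd(\varphi\to\psi)\to\psi$; $\varphi\to\psi,\psi\to\chi\rhd\varphi\to\chi$; $\neg\varphi\vee\neg\psi\rhd\neg(\varphi\wedge\psi)$; $\chi\to\varphi,\chi\to\psi\rhd\chi\to\varphi\wedge\psi$; $\varphi\to\chi,\psi\to\chi\rhd\varphi\vee\psi\to\chi$. $\mathrm{QL}_0$: all substitution instances of these plus $(\forall x)\varphi(x)\to\varphi(t)$; $\varphi(t)\to(\exists x)\varphi(x)$; $\chi\to\psi\rhd\chi\to(\forall x)\psi$; $\psi\to\chi\rhd(\exists x)\psi\to\chi$ ($t$ substitutable for $x$, $x$ not free in $\chi$); $x=x$; $x=y\to y=x$; $x=y\to(y=z\to x=z)$; $x=y\to t(x)=t(y)$; $x=y\to(\varphi(x)\to\varphi(y))$.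 $t\neq s$ abbreviates $\neg(t=s)$. Arithmetical language: $\overline{0}$, $S$, $=$, $\leq$, ternary $A,M$; numerals $\overline{n}=S\cdots S(\overline{0})$. $(\forall x\leq y)\varphi:=(\forall x)(\neg(x\leq y)\vee\varphi)$, $(\exists x\leq y)\varphi:=(\exists x)(x\leq y\wedge\varphi)$; $\Delta_0$-formulas are those all of whose quantifiers are of these bounded forms; $\Sigma_1$-formulas are $(\exists x)\psi$ with $\psi$ a $\Delta_0$-formula. $R^\backsim$: axioms $A(\overline{m},\overline{n},x)\leftrightarrow\overline{m+n}=x$; $M(\overline{m},\overline{n},x)\leftrightarrow\overline{m\cdot n}=x$; $\overline{m}\neq\overline{n}$ for $m\neq n$; $x\leq\overline{n}\leftrightarrow(x=\overline{0}\vee\dots\vee x=\overline{n})$; $x\leq\overline{n}\vee\overline{n}\leq x$; $x\leq\overline{n}\vee\neg(x\leq\overline{n})$. $\mathbb{N}$: standard model with $A(k,l,m)$ iff $k+l=m$, $M(k,l,m)$ iff $k\cdot l=m$, usual $S,\leq$, everything interpreted classically.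
   Formalization: As stated it fails: the logic has no ⊥→χ, so the true (∃x)(⊥→0=S0) is underivable. Proved instead: the equivalence for Σ₁-formulas using → only as negation, and for all Σ₁-formulas with the schema ⊥→χ added; bounded quantifiers need x distinct from y. *)

theory Defs
  imports Main
begin

datatype tm = Var nat | Zero | Sc tm

datatype fm =
    Eq tm tm | Le tm tm | Add tm tm tm | Mul tm tm tm
  | Bot | Imp fm fm | And fm fm | Or fm fm | All nat fm | Ex nat fm

abbreviation Neg :: "fm \<Rightarrow> fm" where "Neg \<phi> \<equiv> Imp \<phi> Bot"

abbreviation Iff :: "fm \<Rightarrow> fm \<Rightarrow> fm" where
  "Iff \<phi> \<psi> \<equiv> And (Imp \<phi> \<psi>) (Imp \<psi> \<phi>)"

abbreviation AllLe :: "nat \<Rightarrow> nat \<Rightarrow> fm \<Rightarrow> fm" where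
  "AllLe x y \<phi> \<equiv> All x (Or (Neg (Le (Var x) (Var y))) \<phi>)"

abbreviation ExLe :: "nat \<Rightarrow> nat \<Rightarrow> fm \<Rightarrow> fm" where
  "ExLe x y \<phi> \<equiv> Ex x (And (Le (Var x) (Var y)) \<phi>)"

primrec numl :: "nat \<Rightarrow> tm" where
  "numl 0 = Zero"
| "numl (Suc n) = Sc (numl n)"

primrec fvt :: "tm \<Rightarrow> nat set" where
  "fvt (Var x) = {x}"
| "fvt Zero = {}"
| "fvt (Sc t) = fvt t"

primrec fv :: "fm \<Rightarrow> nat set" where
  "fv (Eq s t) = fvt s \<union> fvt t"
| "fv (Le s t) = fvt s \<union> fvt t"
| "fv (Add s t u) = fvt s \<union> fvt t \<union> fvt u"
| "fv (Mul s t u) = fvt s \<union> fvt t \<union> fvt u"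
| "fv Bot = {}"
| "fv (Imp \<phi> \<psi>) = fv \<phi> \<union> fv \<psi>"
| "fv (And \<phi> \<psi>) = fv \<phi> \<union> fv \<psi>"
| "fv (Or \<phi> \<psi>) = fv \<phi> \<union> fv \<psi>"
| "fv (All x \<phi>) = fv \<phi> - {x}"
| "fv (Ex x \<phi>) = fv \<phi> - {x}"

text \<open>Simultaneous substitution for the free occurrences of variables. Bound variables are not
  renamed, so it is only meaningful when no capture occurs (see \<open>substitutable\<close>).\<close>

primrec substt :: "(nat \<Rightarrow> tm) \<Rightarrow> tm \<Rightarrow> tm" where
  "substt \<sigma> (Var x) = \<sigma> x"
| "substt \<sigma> Zero = Zero"
| "substt \<sigma> (Sc t) = Sc (substt \<sigma> t)"

primrec subst :: "(nat \<Rightarrow> tm) \<Rightarrow> fm \<Rightarrow> fm" where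
  "subst \<sigma> (Eq s t) = Eq (substt \<sigma> s) (substt \<sigma> t)"
| "subst \<sigma> (Le s t) = Le (substt \<sigma> s) (substt \<sigma> t)"
| "subst \<sigma> (Add s t u) = Add (substt \<sigma> s) (substt \<sigma> t) (substt \<sigma> u)"
| "subst \<sigma> (Mul s t u) = Mul (substt \<sigma> s) (substt \<sigma> t) (substt \<sigma> u)"
| "subst \<sigma> Bot = Bot"
| "subst \<sigma> (Imp \<phi> \<psi>) = Imp (subst \<sigma> \<phi>) (subst \<sigma> \<psi>)"
| "subst \<sigma> (And \<phi> \<psi>) = And (subst \<sigma> \<phi>) (subst \<sigma> \<psi>)"
| "subst \<sigma> (Or \<phi> \<psi>) = Or (subst \<sigma> \<phi>) (subst \<sigma> \<psi>)"
| "subst \<sigma> (All x \<phi>) = All x (subst (\<sigma>(x := Var x)) \<phi>)"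
| "subst \<sigma> (Ex x \<phi>) = Ex x (subst (\<sigma>(x := Var x)) \<phi>)"

abbreviation subst1t :: "nat \<Rightarrow> tm \<Rightarrow> tm \<Rightarrow> tm" where
  "subst1t x t \<equiv> substt (Var(x := t))"

abbreviation subst1 :: "nat \<Rightarrow> tm \<Rightarrow> fm \<Rightarrow> fm" where
  "subst1 x t \<equiv> subst (Var(x := t))"

primrec substitutable :: "tm \<Rightarrow> nat \<Rightarrow> fm \<Rightarrow> bool" where
  "substitutable t x (Eq _ _) \<longleftrightarrow> True"
| "substitutable t x (Le _ _) \<longleftrightarrow> True"
| "substitutable t x (Add _ _ _) \<longleftrightarrow> True"
| "substitutable t x (Mul _ _ _) \<longleftrightarrow> True"
| "substitutable t x Bot \<longleftrightarrow> True"
| "substitutable t x (Imp \<phi> \<psi>) \<longleftrightarrow> substitutable t x \<phi> \<and> substitutable t x \<psi>"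
| "substitutable t x (And \<phi> \<psi>) \<longleftrightarrow> substitutable t x \<phi> \<and> substitutable t x \<psi>"
| "substitutable t x (Or \<phi> \<psi>) \<longleftrightarrow> substitutable t x \<phi> \<and> substitutable t x \<psi>"
| "substitutable t x (All y \<phi>) \<longleftrightarrow>
     x \<notin> fv (All y \<phi>) \<or> (y \<notin> fvt t \<and> substitutable t x \<phi>)"
| "substitutable t x (Ex y \<phi>) \<longleftrightarrow>
     x \<notin> fv (Ex y \<phi>) \<or> (y \<notin> fvt t \<and> substitutable t x \<phi>)"

text \<open>Derivability in \<open>QL\<^sub>0\<close> from a set of formulas, which need not be closed. There is no axiom
  \<open>\<bottom> \<rightarrow> \<phi>\<close>.\<close>

inductive QL0 :: "fm set \<Rightarrow> fm \<Rightarrow> bool" (infix "\<turnstile>" 50) for \<Gamma> :: "fm set" where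
  hyp: "\<phi> \<in> \<Gamma> \<Longrightarrow> \<Gamma> \<turnstile> \<phi>"
| ident: "\<Gamma> \<turnstile> Imp \<phi> \<phi>"
| conjE1: "\<Gamma> \<turnstile> Imp (And \<phi> \<psi>) \<phi>"
| conjE2: "\<Gamma> \<turnstile> Imp (And \<phi> \<psi>) \<psi>"
| disjI1: "\<Gamma> \<turnstile> Imp \<phi> (Or \<phi> \<psi>)"
| disjI2: "\<Gamma> \<turnstile> Imp \<psi> (Or \<phi> \<psi>)"
| weak: "\<Gamma> \<turnstile> \<phi> \<Longrightarrow> \<Gamma> \<turnstile> Imp \<psi> \<phi>"
| mp: "\<Gamma> \<turnstile> \<phi> \<Longrightarrow> \<Gamma> \<turnstile> Imp \<phi> \<psi> \<Longrightarrow> \<Gamma> \<turnstile> \<psi>"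
| assertion: "\<Gamma> \<turnstile> \<phi> \<Longrightarrow> \<Gamma> \<turnstile> Imp (Imp \<phi> \<psi>) \<psi>"
| trans: "\<Gamma> \<turnstile> Imp \<phi> \<psi> \<Longrightarrow> \<Gamma> \<turnstile> Imp \<psi> \<chi> \<Longrightarrow> \<Gamma> \<turnstile> Imp \<phi> \<chi>"
| deMorgan: "\<Gamma> \<turnstile> Or (Neg \<phi>) (Neg \<psi>) \<Longrightarrow> \<Gamma> \<turnstile> Neg (And \<phi> \<psi>)"
| conjI: "\<Gamma> \<turnstile> Imp \<chi> \<phi> \<Longrightarrow> \<Gamma> \<turnstile> Imp \<chi> \<psi> \<Longrightarrow> \<Gamma> \<turnstile> Imp \<chi> (And \<phi> \<psi>)"
| disjE: "\<Gamma> \<turnstile> Imp \<phi> \<chi> \<Longrightarrow> \<Gamma> \<turnstile> Imp \<psi> \<chi> \<Longrightarrow> \<Gamma> \<turnstile> Imp (Or \<phi> \<psi>) \<chi>"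
| allE: "substitutable t x \<phi> \<Longrightarrow> \<Gamma> \<turnstile> Imp (All x \<phi>) (subst1 x t \<phi>)"
| exI: "substitutable t x \<phi> \<Longrightarrow> \<Gamma> \<turnstile> Imp (subst1 x t \<phi>) (Ex x \<phi>)"
| allI: "\<Gamma> \<turnstile> Imp \<chi> \<psi> \<Longrightarrow> x \<notin> fv \<chi> \<Longrightarrow> \<Gamma> \<turnstile> Imp \<chi> (All x \<psi>)"
| exE: "\<Gamma> \<turnstile> Imp \<psi> \<chi> \<Longrightarrow> x \<notin> fv \<chi> \<Longrightarrow> \<Gamma> \<turnstile> Imp (Ex x \<psi>) \<chi>"
| eq_refl: "\<Gamma> \<turnstile> Eq (Var x) (Var x)"
| eq_sym: "\<Gamma> \<turnstile> Imp (Eq (Var x) (Var y)) (Eq (Var y) (Var x))"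
| eq_trans: "\<Gamma> \<turnstile> Imp (Eq (Var x) (Var y)) (Imp (Eq (Var y) (Var z)) (Eq (Var x) (Var z)))"
| eq_tm: "\<Gamma> \<turnstile> Imp (Eq (Var x) (Var y)) (Eq t (subst1t x (Var y) t))"
| eq_fm: "substitutable (Var y) x \<phi> \<Longrightarrow>
    \<Gamma> \<turnstile> Imp (Eq (Var x) (Var y)) (Imp \<phi> (subst1 x (Var y) \<phi>))"

text \<open>\<open>x = 0 \<or> \<dots> \<or> x = n\<close>, associated to the left.\<close>

primrec eq_upto :: "nat \<Rightarrow> nat \<Rightarrow> fm" where
  "eq_upto x 0 = Eq (Var x) Zero"
| "eq_upto x (Suc n) = Or (eq_upto x n) (Eq (Var x) (numl (Suc n)))"

inductive_set R_sim :: "fm set" where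
  "Iff (Add (numl m) (numl n) (Var x)) (Eq (numl (m + n)) (Var x)) \<in> R_sim"
| "Iff (Mul (numl m) (numl n) (Var x)) (Eq (numl (m * n)) (Var x)) \<in> R_sim"
| "m \<noteq> n \<Longrightarrow> Neg (Eq (numl m) (numl n)) \<in> R_sim"
| "Iff (Le (Var x) (numl n)) (eq_upto x n) \<in> R_sim"
| "Or (Le (Var x) (numl n)) (Le (numl n) (Var x)) \<in> R_sim"
| "Or (Le (Var x) (numl n)) (Neg (Le (Var x) (numl n))) \<in> R_sim"

text \<open>The condition \<open>x \<noteq> y\<close> is the usual proviso on bounded quantifiers: \<open>(\<exists>x\<le>x)\<phi>\<close> would
  be unbounded.\<close>

inductive Delta0 :: "fm \<Rightarrow> bool" where
  "Delta0 (Eq s t)"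
| "Delta0 (Le s t)"
| "Delta0 (Add s t u)"
| "Delta0 (Mul s t u)"
| "Delta0 Bot"
| "Delta0 \<phi> \<Longrightarrow> Delta0 \<psi> \<Longrightarrow> Delta0 (Imp \<phi> \<psi>)"
| "Delta0 \<phi> \<Longrightarrow> Delta0 \<psi> \<Longrightarrow> Delta0 (And \<phi> \<psi>)"
| "Delta0 \<phi> \<Longrightarrow> Delta0 \<psi> \<Longrightarrow> Delta0 (Or \<phi> \<psi>)"
| "Delta0 \<phi> \<Longrightarrow> x \<noteq> y \<Longrightarrow> Delta0 (AllLe x y \<phi>)"
| "Delta0 \<phi> \<Longrightarrow> x \<noteq> y \<Longrightarrow> Delta0 (ExLe x y \<phi>)"

definition Sigma1 :: "fm \<Rightarrow> bool" where
  "Sigma1 \<phi> \<longleftrightarrow> (\<exists>x \<psi>. \<phi> = Ex x \<psi> \<and> Delta0 \<psi>)"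

primrec eval :: "(nat \<Rightarrow> nat) \<Rightarrow> tm \<Rightarrow> nat" where
  "eval e (Var x) = e x"
| "eval e Zero = 0"
| "eval e (Sc t) = Suc (eval e t)"

primrec sat :: "(nat \<Rightarrow> nat) \<Rightarrow> fm \<Rightarrow> bool" where
  "sat e (Eq s t) \<longleftrightarrow> eval e s = eval e t"
| "sat e (Le s t) \<longleftrightarrow> eval e s \<le> eval e t"
| "sat e (Add s t u) \<longleftrightarrow> eval e s + eval e t = eval e u"
| "sat e (Mul s t u) \<longleftrightarrow> eval e s * eval e t = eval e u"
| "sat e Bot \<longleftrightarrow> False"
| "sat e (Imp \<phi> \<psi>) \<longleftrightarrow> (sat e \<phi> \<longrightarrow> sat e \<psi>)"
| "sat e (And \<phi> \<psi>) \<longleftrightarrow> sat e \<phi> \<and> sat e \<psi>"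
| "sat e (Or \<phi> \<psi>) \<longleftrightarrow> sat e \<phi> \<or> sat e \<psi>"
| "sat e (All x \<phi>) \<longleftrightarrow> (\<forall>n. sat (e(x := n)) \<phi>)"
| "sat e (Ex x \<phi>) \<longleftrightarrow> (\<exists>n. sat (e(x := n)) \<phi>)"

text \<open>\<open>\<nat> \<Turnstile> \<phi>(k\<^sub>1,\<dots>,k\<^sub>n)\<close> and \<open>\<phi>(k\<^sub>1,\<dots>,k\<^sub>n)\<close> with numerals, for a formula \<open>\<phi>\<close> whose free
  variables are among the distinct variables \<open>xs = [x\<^sub>1,\<dots>,x\<^sub>n]\<close>.\<close>

definition N_models :: "fm \<Rightarrow> nat list \<Rightarrow> nat list \<Rightarrow> bool" where
  "N_models \<phi> xs ks \<longleftrightarrow> (\<forall>e. map e xs = ks \<longrightarrow> sat e \<phi>)"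

definition num_inst :: "fm \<Rightarrow> nat list \<Rightarrow> nat list \<Rightarrow> fm" where
  "num_inst \<phi> xs ks =
     subst (\<lambda>v. case map_of (zip xs ks) v of None \<Rightarrow> Var v | Some k \<Rightarrow> numl k) \<phi>"

text \<open>\<open>QL\<^sub>0\<close> imposes nothing on \<open>\<bottom>\<close>: all its axioms and rules and all axioms of \<open>R_sim\<close> remain
  valid in the standard model when \<open>\<bottom>\<close> is read as true. Hence the true formula
  \<open>(\<exists>x)(\<bottom> \<rightarrow> 0 = S 0)\<close> is not derivable, and an implication whose antecedent and consequent
  are both false is in general underivable. The two notions below isolate the two ways around
  this: to use implication in the formula only as negation, or to add the schema \<open>\<bottom> \<rightarrow> \<chi>\<close>.\<close>

primrec imp_only_neg :: "fm \<Rightarrow> bool" where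
  "imp_only_neg (Eq _ _) \<longleftrightarrow> True"
| "imp_only_neg (Le _ _) \<longleftrightarrow> True"
| "imp_only_neg (Add _ _ _) \<longleftrightarrow> True"
| "imp_only_neg (Mul _ _ _) \<longleftrightarrow> True"
| "imp_only_neg Bot \<longleftrightarrow> True"
| "imp_only_neg (Imp \<phi> \<psi>) \<longleftrightarrow> imp_only_neg \<phi> \<and> \<psi> = Bot"
| "imp_only_neg (And \<phi> \<psi>) \<longleftrightarrow> imp_only_neg \<phi> \<and> imp_only_neg \<psi>"
| "imp_only_neg (Or \<phi> \<psi>) \<longleftrightarrow> imp_only_neg \<phi> \<and> imp_only_neg \<psi>"
| "imp_only_neg (All _ \<phi>) \<longleftrightarrow> imp_only_neg \<phi>"
| "imp_only_neg (Ex _ \<phi>) \<longleftrightarrow> imp_only_neg \<phi>"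

definition Ex_falso :: "fm set" where
  "Ex_falso = {Imp Bot \<chi> | \<chi>. True}"

end

theory Submission
  imports Defs
begin

text \<open>Soundness in the standard model gives one direction. For the other, every instance of a
  \<open>\<Delta>\<^sub>0\<close>-formula by numerals is decided in the sense that it or its negation is derivable, by
  induction on the formula; \<open>\<bottom> \<rightarrow> \<chi>\<close> is needed only for implications \<open>\<phi> \<rightarrow> \<chi>\<close> with \<open>\<phi>\<close> false. As no deduction theorem is available, the quantifier cases rest on
  the following: if \<open>\<psi>(n)\<close> is derivable for all \<open>n \<le> N\<close>, then so is \<open>x \<le> N \<rightarrow> \<psi>(x)\<close>, because
  \<open>x = n\<close> implies \<open>\<psi>(n) \<rightarrow> \<psi>(x)\<close>, which implies \<open>\<psi>(x)\<close> by the assertion rule. Decidability of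
  \<open>x \<le> N\<close> turns this into \<open>\<not>(x \<le> N) \<or> \<psi>(x)\<close>, which settles a true universal quantifier and, for
  a negated \<open>\<psi>\<close> and through the De Morgan rule, a false existential one.\<close>

section \<open>Substitution\<close>

text \<open>Bound variables count as well: a variable outside \<open>vars \<phi>\<close> is neither
  free in \<open>\<phi>\<close> nor able to be captured by one of its quantifiers.\<close>

primrec vars :: "fm \<Rightarrow> nat set" where
  "vars (Eq s t) = fvt s \<union> fvt t"
| "vars (Le s t) = fvt s \<union> fvt t"
| "vars (Add s t u) = fvt s \<union> fvt t \<union> fvt u"
| "vars (Mul s t u) = fvt s \<union> fvt t \<union> fvt u"
| "vars Bot = {}"
| "vars (Imp \<phi> \<psi>) = vars \<phi> \<union> vars \<psi>"
| "vars (And \<phi> \<psi>) = vars \<phi> \<union> vars \<psi>"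
| "vars (Or \<phi> \<psi>) = vars \<phi> \<union> vars \<psi>"
| "vars (All x \<phi>) = insert x (vars \<phi>)"
| "vars (Ex x \<phi>) = insert x (vars \<phi>)"

lemma finite_fvt: "finite (fvt t)"
  by (induction t) auto

lemma finite_vars: "finite (vars \<phi>)"
  by (induction \<phi>) (auto simp: finite_fvt)

lemma fv_subset_vars: "fv \<phi> \<subseteq> vars \<phi>"
  by (induction \<phi>) auto

lemma fvt_numl [simp]: "fvt (numl n) = {}"
  by (induction n) auto

lemma substt_cong: "(\<And>v. v \<in> fvt t \<Longrightarrow> \<sigma> v = \<tau> v) \<Longrightarrow> substt \<sigma> t = substt \<tau> t"
  by (induction t) auto

lemma subst_cong: "(\<And>v. v \<in> fv \<phi> \<Longrightarrow> \<sigma> v = \<tau> v) \<Longrightarrow> subst \<sigma> \<phi> = subst \<tau> \<phi>"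
proof (induction \<phi> arbitrary: \<sigma> \<tau>)
  case (All x \<phi>)
  have "subst (\<sigma>(x := Var x)) \<phi> = subst (\<tau>(x := Var x)) \<phi>"
    using All.prems by (intro All.IH) auto
  then show ?case by (simp del: fun_upd_apply)
next
  case (Ex x \<phi>)
  have "subst (\<sigma>(x := Var x)) \<phi> = subst (\<tau>(x := Var x)) \<phi>"
    using Ex.prems by (intro Ex.IH) auto
  then show ?case by (simp del: fun_upd_apply)
next
  case (Imp \<phi> \<psi>)
  show ?case using Imp.IH[of \<sigma> \<tau>] Imp.prems by simp
next
  case (And \<phi> \<psi>)
  show ?case using And.IH[of \<sigma> \<tau>] And.prems by simp
next
  case (Or \<phi> \<psi>)
  show ?case using Or.IH[of \<sigma> \<tau>] Or.prems by simp
next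
  case (Eq s t)
  then show ?case
    using substt_cong[of s \<sigma> \<tau>] substt_cong[of t \<sigma> \<tau>] by simp
next
  case (Le s t)
  then show ?case
    using substt_cong[of s \<sigma> \<tau>] substt_cong[of t \<sigma> \<tau>] by simp
next
  case (Add s t u)
  then show ?case
    using substt_cong[of s \<sigma> \<tau>] substt_cong[of t \<sigma> \<tau>] substt_cong[of u \<sigma> \<tau>] by simp
next
  case (Mul s t u)
  then show ?case
    using substt_cong[of s \<sigma> \<tau>] substt_cong[of t \<sigma> \<tau>] substt_cong[of u \<sigma> \<tau>] by simp
qed simp

lemma substt_Var [simp]: "substt Var t = t"
  by (induction t) auto

lemma subst_Var [simp]: "subst Var \<phi> = \<phi>"
  by (induction \<phi>) auto

lemma substt_closed [simp]: "fvt t = {} \<Longrightarrow> substt \<sigma> t = t"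
  by (induction t) auto

lemma subst1_fresh: "x \<notin> fv \<phi> \<Longrightarrow> subst1 x t \<phi> = \<phi>"
  using subst_cong[of \<phi> "Var(x := t)" Var] by (metis fun_upd_other subst_Var)

lemma substt_substt: "substt \<tau> (substt \<sigma> t) = substt (\<lambda>v. substt \<tau> (\<sigma> v)) t"
  by (induction t) auto

lemma substitutable_closed: "fvt t = {} \<Longrightarrow> substitutable t x \<phi>"
  by (induction \<phi>) auto

text \<open>The condition on \<open>\<sigma>\<close> survives the update
  \<open>\<sigma>(x := Var x)\<close> at a quantifier. Under it the bound \<open>x\<close> cannot
  occur in \<open>\<sigma> v\<close> for \<open>v \<noteq> x\<close>, so resetting
  \<open>\<tau>\<close> at \<open>x\<close> does not affect these terms.\<close>

lemma subst_subst_closed: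
  assumes "\<And>v. fvt (\<sigma> v) = {} \<or> \<sigma> v = Var v"
  shows "subst \<tau> (subst \<sigma> \<phi>) = subst (\<lambda>v. substt \<tau> (\<sigma> v)) \<phi>"
  using assms
proof (induction \<phi> arbitrary: \<sigma> \<tau>)
  case (All x \<phi>)
  have "subst (\<tau>(x := Var x)) (subst (\<sigma>(x := Var x)) \<phi>)
      = subst (\<lambda>v. substt (\<tau>(x := Var x)) ((\<sigma>(x := Var x)) v)) \<phi>"
    using All.prems by (intro All.IH) simp
  also have "(\<lambda>v. substt (\<tau>(x := Var x)) ((\<sigma>(x := Var x)) v))
      = (\<lambda>v. substt \<tau> (\<sigma> v))(x := Var x)"
  proof
    fix v
    show "substt (\<tau>(x := Var x)) ((\<sigma>(x := Var x)) v) = ((\<lambda>v. substt \<tau> (\<sigma> v))(x := Var x)) v"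
      using All.prems[of v] by auto
  qed
  finally show ?case by (simp del: fun_upd_apply)
next
  case (Ex x \<phi>)
  have "subst (\<tau>(x := Var x)) (subst (\<sigma>(x := Var x)) \<phi>)
      = subst (\<lambda>v. substt (\<tau>(x := Var x)) ((\<sigma>(x := Var x)) v)) \<phi>"
    using Ex.prems by (intro Ex.IH) simp
  also have "(\<lambda>v. substt (\<tau>(x := Var x)) ((\<sigma>(x := Var x)) v))
      = (\<lambda>v. substt \<tau> (\<sigma> v))(x := Var x)"
  proof
    fix v
    show "substt (\<tau>(x := Var x)) ((\<sigma>(x := Var x)) v) = ((\<lambda>v. substt \<tau> (\<sigma> v))(x := Var x)) v"
      using Ex.prems[of v] by auto
  qed
  finally show ?case by (simp del: fun_upd_apply)
qed (simp_all add: substt_substt)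

lemma Var_fun_upd_absorb: "w \<noteq> x \<Longrightarrow> Var(x := t, w := Var w) = Var(x := t)"
  by auto

lemma subst1t_rename: "z \<notin> fvt s \<Longrightarrow> subst1t z t (subst1t x (Var z) s) = subst1t x t s"
  by (induction s) auto

text \<open>No quantifier of \<open>\<phi>\<close> binds \<open>z\<close>, so the inserted
  \<open>z\<close> stays free and is replaced in turn. Below a quantifier over \<open>x\<close>
  nothing is inserted, and \<open>z\<close> is not free there.\<close>

lemma subst1_rename: "z \<notin> vars \<phi> \<Longrightarrow> subst1 z t (subst1 x (Var z) \<phi>) = subst1 x t \<phi>"
proof (induction \<phi>)
  case (All w \<phi>)
  then have "z \<notin> fv \<phi>"
    using fv_subset_vars by auto
  with All show ?case
    by (cases "w = x") (auto simp: Var_fun_upd_absorb subst1_fresh simp del: fun_upd_apply)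
next
  case (Ex w \<phi>)
  then have "z \<notin> fv \<phi>"
    using fv_subset_vars by auto
  with Ex show ?case
    by (cases "w = x") (auto simp: Var_fun_upd_absorb subst1_fresh simp del: fun_upd_apply)
qed (simp_all add: subst1t_rename)

text \<open>The free occurrences of \<open>z\<close> stand where \<open>x\<close> was free in
  \<open>\<phi>\<close>, hence never in the scope of a quantifier over \<open>x\<close>.\<close>

lemma substitutable_rename: "z \<notin> vars \<phi> \<Longrightarrow> substitutable (Var x) z (subst1 x (Var z) \<phi>)"
proof (induction \<phi>)
  case (All w \<phi>)
  then show ?case
    using fv_subset_vars[of \<phi>]
    by (cases "w = x") (auto simp: Var_fun_upd_absorb simp del: fun_upd_apply)
next
  case (Ex w \<phi>)
  then show ?case
    using fv_subset_vars[of \<phi>]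
    by (cases "w = x") (auto simp: Var_fun_upd_absorb simp del: fun_upd_apply)
qed simp_all

text \<open>Links the body of a quantified instance, where \<open>x\<close> is kept as a variable,
  to the numeral instances for which the induction hypothesis speaks.\<close>

lemma subst1_subst_numl:
  "subst1 x (numl k) (subst ((\<lambda>v. numl (e v))(x := Var x)) \<phi>) = subst (\<lambda>v. numl ((e(x := k)) v)) \<phi>"
proof -
  have "subst1 x (numl k) (subst ((\<lambda>v. numl (e v))(x := Var x)) \<phi>)
      = subst (\<lambda>v. substt (Var(x := numl k)) (((\<lambda>v. numl (e v))(x := Var x)) v)) \<phi>"
    by (rule subst_subst_closed) simp
  also have "\<dots> = subst (\<lambda>v. numl ((e(x := k)) v)) \<phi>"
    by (rule subst_cong) simp
  finally show ?thesis .
qed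

section \<open>Soundness in the standard model\<close>

lemma eval_numl [simp]: "eval e (numl n) = n"
  by (induction n) auto

lemma substt_numl: "substt (\<lambda>v. numl (e v)) t = numl (eval e t)"
  by (induction t) auto

lemma eval_substt: "eval e (substt \<sigma> t) = eval (\<lambda>v. eval e (\<sigma> v)) t"
  by (induction t) auto

lemma eval_cong: "(\<And>v. v \<in> fvt t \<Longrightarrow> d v = e v) \<Longrightarrow> eval d t = eval e t"
  by (induction t) auto

lemma sat_cong: "(\<And>v. v \<in> fv \<phi> \<Longrightarrow> d v = e v) \<Longrightarrow> sat d \<phi> = sat e \<phi>"
proof (induction \<phi> arbitrary: d e)
  case (Eq s t)
  then show ?case using eval_cong[of s d e] eval_cong[of t d e] by simp
next
  case (Le s t)
  then show ?case using eval_cong[of s d e] eval_cong[of t d e] by simp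
next
  case (Add s t u)
  then show ?case
    using eval_cong[of s d e] eval_cong[of t d e] eval_cong[of u d e] by simp
next
  case (Mul s t u)
  then show ?case
    using eval_cong[of s d e] eval_cong[of t d e] eval_cong[of u d e] by simp
next
  case (Imp \<phi> \<psi>)
  show ?case using Imp.IH[of d e] Imp.prems by simp
next
  case (And \<phi> \<psi>)
  show ?case using And.IH[of d e] And.prems by simp
next
  case (Or \<phi> \<psi>)
  show ?case using Or.IH[of d e] Or.prems by simp
next
  case (All x \<phi>)
  have "sat (d(x := n)) \<phi> = sat (e(x := n)) \<phi>" for n
    using All.prems by (intro All.IH) auto
  then show ?case by simp
next
  case (Ex x \<phi>)
  have "sat (d(x := n)) \<phi> = sat (e(x := n)) \<phi>" for n
    using Ex.prems by (intro Ex.IH) auto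
  then show ?case by simp
qed simp

lemma sat_fun_upd_fresh: "x \<notin> fv \<phi> \<Longrightarrow> sat (e(x := n)) \<phi> = sat e \<phi>"
  by (rule sat_cong) auto

lemma eval_subst1t: "eval e (subst1t x t s) = eval (e(x := eval e t)) s"
  by (induction s) auto

lemma sat_subst1:
  "substitutable t x \<phi> \<Longrightarrow> sat e (subst1 x t \<phi>) = sat (e(x := eval e t)) \<phi>"
proof (induction \<phi> arbitrary: e)
  case (All y \<phi>)
  show ?case
  proof (cases "x \<in> fv (All y \<phi>)")
    case False
    then show ?thesis
      using subst1_fresh[OF False, of t] sat_fun_upd_fresh[OF False, of e "eval e t"] by argo
  next
    case True
    then have y: "y \<noteq> x" "y \<notin> fvt t" "substitutable t x \<phi>"
      using All.prems by auto
    \<comment> \<open>Substitutability excludes \<open>y\<close> from \<open>t\<close>, so the value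
      of \<open>t\<close> is the same inside the quantifier as outside.\<close>
    have "eval (e(y := n)) t = eval e t" for n
      using y by (intro eval_cong) auto
    then show ?thesis
      using y All.IH by (simp add: Var_fun_upd_absorb fun_upd_twist[OF y(1)] del: fun_upd_apply)
  qed
next
  case (Ex y \<phi>)
  show ?case
  proof (cases "x \<in> fv (Ex y \<phi>)")
    case False
    then show ?thesis
      using subst1_fresh[OF False, of t] sat_fun_upd_fresh[OF False, of e "eval e t"] by argo
  next
    case True
    then have y: "y \<noteq> x" "y \<notin> fvt t" "substitutable t x \<phi>"
      using Ex.prems by auto
    have "eval (e(y := n)) t = eval e t" for n
      using y by (intro eval_cong) auto
    then show ?thesis
      using y Ex.IH by (simp add: Var_fun_upd_absorb fun_upd_twist[OF y(1)] del: fun_upd_apply)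
  qed
qed (simp_all add: eval_subst1t)

lemma sat_subst_closed:
  assumes "\<And>v. fvt (\<sigma> v) = {} \<or> \<sigma> v = Var v"
  shows "sat d (subst \<sigma> \<phi>) \<longleftrightarrow> sat (\<lambda>v. eval d (\<sigma> v)) \<phi>"
  using assms
proof (induction \<phi> arbitrary: \<sigma> d)
  case (All x \<phi>)
  have "(\<lambda>v. eval (d(x := n)) ((\<sigma>(x := Var x)) v)) = (\<lambda>v. eval d (\<sigma> v))(x := n)" for n
  proof
    fix v
    show "eval (d(x := n)) ((\<sigma>(x := Var x)) v) = ((\<lambda>v. eval d (\<sigma> v))(x := n)) v"
      using All.prems[of v] eval_cong[of "\<sigma> v" "d(x := n)" d] by auto
  qed
  moreover have "sat d (subst (\<sigma>(x := Var x)) \<phi>)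
      \<longleftrightarrow> sat (\<lambda>v. eval d ((\<sigma>(x := Var x)) v)) \<phi>" for d
    using All.prems by (intro All.IH) simp
  ultimately show ?case by simp
next
  case (Ex x \<phi>)
  have "(\<lambda>v. eval (d(x := n)) ((\<sigma>(x := Var x)) v)) = (\<lambda>v. eval d (\<sigma> v))(x := n)" for n
  proof
    fix v
    show "eval (d(x := n)) ((\<sigma>(x := Var x)) v) = ((\<lambda>v. eval d (\<sigma> v))(x := n)) v"
      using Ex.prems[of v] eval_cong[of "\<sigma> v" "d(x := n)" d] by auto
  qed
  moreover have "sat d (subst (\<sigma>(x := Var x)) \<phi>)
      \<longleftrightarrow> sat (\<lambda>v. eval d ((\<sigma>(x := Var x)) v)) \<phi>" for d
    using Ex.prems by (intro Ex.IH) simp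
  ultimately show ?case by simp
qed (simp_all add: eval_substt)

text \<open>Every variable is replaced by a closed term, so the assignment \<open>d\<close> is
  irrelevant.\<close>

lemma sat_subst_numl: "sat d (subst (\<lambda>v. numl (e v)) \<phi>) \<longleftrightarrow> sat e \<phi>"
  by (simp add: sat_subst_closed)

text \<open>Hypotheses may be open and the quantifier rules put no restriction on them, so they have
  to hold under every assignment, and the induction ranges over all \<open>e\<close>.\<close>

lemma QL0_sound:
  assumes "\<Gamma> \<turnstile> \<phi>" and "\<And>\<psi> e. \<psi> \<in> \<Gamma> \<Longrightarrow> sat e \<psi>"
  shows "sat e \<phi>"
  using assms(1)
proof (induction arbitrary: e rule: QL0.induct)
  case (eq_tm x y t)
  show ?case
    \<comment> \<open>If \<open>e x = e y\<close>, then \<open>e(x := e y)\<close> is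
      \<open>e\<close> itself.\<close>
    by (auto simp: eval_subst1t fun_upd_idem simp del: fun_upd_apply)
next
  case (eq_fm y x \<phi>)
  then show ?case
    by (auto simp: sat_subst1 fun_upd_idem simp del: fun_upd_apply)
next
  case (allE t x \<phi>)
  then show ?case by (simp add: sat_subst1)
next
  case (exI t x \<phi>)
  then show ?case by (auto simp: sat_subst1)
next
  case (allI \<chi> \<psi> x)
  then show ?case by (metis sat.simps(6,9) sat_fun_upd_fresh)
next
  case (exE \<psi> \<chi> x)
  then show ?case by (metis sat.simps(6,10) sat_fun_upd_fresh)
qed (auto simp: assms(2))

lemma sat_eq_upto: "sat e (eq_upto x n) \<longleftrightarrow> e x \<le> n"
  by (induction n) auto

lemma sat_R_sim: "\<phi> \<in> R_sim \<Longrightarrow> sat e \<phi>"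
  by (induction rule: R_sim.induct) (auto simp: sat_eq_upto)

lemma sat_Ex_falso: "\<phi> \<in> Ex_falso \<Longrightarrow> sat e \<phi>"
  by (auto simp: Ex_falso_def)

section \<open>Derived rules\<close>

text \<open>The rule \<open>allI\<close> acts below an implication, so the closed theorem
  \<open>Imp Bot Bot\<close> is put in front as an antecedent and detached afterwards.\<close>

lemma QL0_gen: "\<Gamma> \<turnstile> \<phi> \<Longrightarrow> \<Gamma> \<turnstile> All x \<phi>"
  using QL0.mp[OF QL0.ident[of \<Gamma> Bot] QL0.allI[OF QL0.weak, of \<Gamma> \<phi> x]] by simp

lemma QL0_inst: "\<Gamma> \<turnstile> \<phi> \<Longrightarrow> substitutable t x \<phi> \<Longrightarrow> \<Gamma> \<turnstile> subst1 x t \<phi>"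
  by (rule QL0.mp[OF QL0_gen QL0.allE])

lemma QL0_inst_numl: "\<Gamma> \<turnstile> \<phi> \<Longrightarrow> \<Gamma> \<turnstile> subst1 x (numl n) \<phi>"
  by (rule QL0_inst) (simp_all add: substitutable_closed)

lemma QL0_Ex_numl:
  "\<Gamma> \<turnstile> subst (\<lambda>v. numl ((e(x := k)) v)) \<phi> \<Longrightarrow> \<Gamma> \<turnstile> subst (\<lambda>v. numl (e v)) (Ex x \<phi>)"
  using QL0.mp[OF _ QL0.exI[of "numl k" x "subst ((\<lambda>v. numl (e v))(x := Var x)) \<phi>"]]
  by (simp add: substitutable_closed subst1_subst_numl del: fun_upd_apply)

lemma QL0_And: "\<Gamma> \<turnstile> \<phi> \<Longrightarrow> \<Gamma> \<turnstile> \<psi> \<Longrightarrow> \<Gamma> \<turnstile> And \<phi> \<psi>"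
  by (rule QL0.mp[OF QL0.ident[of \<Gamma> Bot] QL0.conjI[OF QL0.weak QL0.weak]])

lemma QL0_numl_refl: "\<Gamma> \<turnstile> Eq (numl n) (numl n)"
  using QL0_inst_numl[OF QL0.eq_refl[of \<Gamma> 0], of 0 n] by simp

lemma QL0_eq_numl_sym: "\<Gamma> \<turnstile> Imp (Eq (Var x) (numl n)) (Eq (numl n) (Var x))"
  \<comment> \<open>\<open>Suc x\<close> merely names a variable different from
    \<open>x\<close>.\<close>
  using QL0_inst_numl[OF QL0.eq_sym[of \<Gamma> x "Suc x"], of "Suc x" n] by simp

text \<open>The detour through a fresh variable \<open>z\<close> is needed because \<open>eq_fm\<close> replaces all free
  occurrences of a variable that must differ from the \<open>x\<close> remaining in the conclusion.\<close>

lemma QL0_Leibniz_numl: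
  "\<Gamma> \<turnstile> Imp (Eq (Var x) (numl n)) (Imp (subst1 x (numl n) \<phi>) \<phi>)"
proof -
  obtain z where z: "z \<notin> insert x (vars \<phi>)"
    using ex_new_if_finite[OF infinite_UNIV_nat] finite_vars by (metis finite_insert)
  then have "z \<notin> fv \<phi>"
    using fv_subset_vars by blast
  have "\<Gamma> \<turnstile> Imp (Eq (Var z) (Var x)) (Imp (subst1 x (Var z) \<phi>) \<phi>)"
    using QL0.eq_fm[OF substitutable_rename, of z \<phi> \<Gamma> x] z subst1_rename[of z \<phi> "Var x" x]
    by simp
  from QL0_inst_numl[OF this, of z n]
  have "\<Gamma> \<turnstile> Imp (Eq (numl n) (Var x)) (Imp (subst1 x (numl n) \<phi>) \<phi>)"
    using z \<open>z \<notin> fv \<phi>\<close> by (simp add: subst1_rename subst1_fresh)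
  then show ?thesis
    by (rule QL0.trans[OF QL0_eq_numl_sym])
qed

lemma QL0_eq_numl_imp:
  assumes "\<Gamma> \<turnstile> subst1 x (numl n) \<phi>"
  shows "\<Gamma> \<turnstile> Imp (Eq (Var x) (numl n)) \<phi>"
  using QL0.trans[OF QL0_Leibniz_numl QL0.assertion[OF assms]] .

text \<open>The parameter \<open>\<sigma>\<close> allows two uses: with \<open>Var\<close> for the
  open formula in \<open>x\<close>, and with \<open>Var(0 := numl m)\<close> for a disjunction of
  equations between numerals.\<close>

lemma QL0_eq_upto_elim:
  "(\<And>k. k \<le> n \<Longrightarrow> \<Gamma> \<turnstile> Imp (Eq (\<sigma> x) (numl k)) \<chi>) \<Longrightarrow> \<Gamma> \<turnstile> Imp (subst \<sigma> (eq_upto x n)) \<chi>"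
proof (induction n)
  case 0
  then show ?case using "0"[of 0] by simp
next
  case (Suc n)
  have "\<Gamma> \<turnstile> Imp (subst \<sigma> (eq_upto x n)) \<chi>"
    using Suc.prems by (intro Suc.IH) simp
  from QL0.disjE[OF this Suc.prems[of "Suc n"]] show ?case by simp
qed

lemma QL0_eq_upto_intro:
  "k \<le> n \<Longrightarrow> \<Gamma> \<turnstile> Imp (Eq (\<sigma> x) (numl k)) (subst \<sigma> (eq_upto x n))"
proof (induction n)
  case 0
  then show ?case by (simp add: QL0.ident)
next
  case (Suc n)
  show ?case
  proof (cases "k = Suc n")
    case True
    then show ?thesis by (simp add: QL0.disjI2)
  next
    case False
    then show ?thesis
      using QL0.trans[OF Suc.IH QL0.disjI1] Suc.prems by simp
  qed
qed

section \<open>Deciding bounded formulas\<close>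

context
  fixes \<Gamma> :: "fm set"
  assumes R_sim: "R_sim \<subseteq> \<Gamma>"
begin

lemma QL0_R_sim: "\<phi> \<in> R_sim \<Longrightarrow> \<Gamma> \<turnstile> \<phi>"
  using R_sim by (auto intro: QL0.hyp)

lemma QL0_R_sim_Iff:
  assumes "Iff \<phi> \<psi> \<in> R_sim"
  shows "\<Gamma> \<turnstile> Imp \<phi> \<psi>" "\<Gamma> \<turnstile> Imp \<psi> \<phi>"
  by (rule QL0.mp[OF QL0_R_sim[OF assms] QL0.conjE1])
    (rule QL0.mp[OF QL0_R_sim[OF assms] QL0.conjE2])

section \<open>Atomic formulas at numerals\<close>

lemma QL0_numl_neq: "m \<noteq> n \<Longrightarrow> \<Gamma> \<turnstile> Neg (Eq (numl m) (numl n))"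
  by (simp add: QL0_R_sim R_sim.intros(3))

lemma QL0_Add_numl:
  "\<Gamma> \<turnstile> Imp (Add (numl m) (numl n) (numl k)) (Eq (numl (m + n)) (numl k))"
  "\<Gamma> \<turnstile> Imp (Eq (numl (m + n)) (numl k)) (Add (numl m) (numl n) (numl k))"
  using QL0_R_sim_Iff[OF R_sim.intros(1)[of m n 0], THEN QL0_inst_numl, of 0 k] by simp_all

lemma QL0_Mul_numl:
  "\<Gamma> \<turnstile> Imp (Mul (numl m) (numl n) (numl k)) (Eq (numl (m * n)) (numl k))"
  "\<Gamma> \<turnstile> Imp (Eq (numl (m * n)) (numl k)) (Mul (numl m) (numl n) (numl k))"
  using QL0_R_sim_Iff[OF R_sim.intros(2)[of m n 0], THEN QL0_inst_numl, of 0 k] by simp_all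

lemma QL0_Le_numl:
  "\<Gamma> \<turnstile> Imp (Le (numl m) (numl n)) (subst1 0 (numl m) (eq_upto 0 n))"
  "\<Gamma> \<turnstile> Imp (subst1 0 (numl m) (eq_upto 0 n)) (Le (numl m) (numl n))"
  using QL0_R_sim_Iff[OF R_sim.intros(4)[of 0 n], THEN QL0_inst_numl, of 0 m] by simp_all

lemma QL0_numl_le: "m \<le> n \<Longrightarrow> \<Gamma> \<turnstile> Le (numl m) (numl n)"
  by (rule QL0.mp[OF QL0.mp[OF QL0_numl_refl] QL0_Le_numl(2)])
    (use QL0_eq_upto_intro[of m n \<Gamma> "Var(0 := numl m)" 0] in simp)

text \<open>The inequality implies a disjunction of equations \<open>m = k\<close> with
  \<open>k \<le> n < m\<close>, each of which is refuted by an axiom.\<close>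

lemma QL0_numl_not_le:
  assumes "\<not> m \<le> n"
  shows "\<Gamma> \<turnstile> Neg (Le (numl m) (numl n))"
proof (rule QL0.trans[OF QL0_Le_numl(1)], rule QL0_eq_upto_elim)
  fix k
  assume "k \<le> n"
  then show "\<Gamma> \<turnstile> Neg (Eq ((Var(0 := numl m)) 0) (numl k))"
    using assms by (simp add: QL0_numl_neq)
qed

lemma QL0_bounded:
  assumes "\<And>k. k \<le> n \<Longrightarrow> \<Gamma> \<turnstile> subst1 x (numl k) \<phi>"
  shows "\<Gamma> \<turnstile> Or (Neg (Le (Var x) (numl n))) \<phi>"
proof -
  have "\<Gamma> \<turnstile> Imp (eq_upto x n) \<phi>"
    using QL0_eq_upto_elim[of n \<Gamma> Var x \<phi>] QL0_eq_numl_imp[OF assms] by simp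
  then have "\<Gamma> \<turnstile> Imp (Le (Var x) (numl n)) \<phi>"
    by (rule QL0.trans[OF QL0_R_sim_Iff(1)[OF R_sim.intros(4)]])
  \<comment> \<open>Both cases of the decidability axiom lead to the goal: the first through the
    implication just derived, the second directly.\<close>
  then have "\<Gamma> \<turnstile> Imp (Or (Le (Var x) (numl n)) (Neg (Le (Var x) (numl n))))
      (Or (Neg (Le (Var x) (numl n))) \<phi>)"
    by (rule QL0.disjE[OF QL0.trans[OF _ QL0.disjI2] QL0.disjI1])
  then show ?thesis
    by (rule QL0.mp[OF QL0_R_sim[OF R_sim.intros(6)]])
qed

text \<open>Derivability of true instances and refutability of false ones are proved together
  because negation exchanges them. The assignment \<open>e\<close> varies in the induction so that
  quantifiers can pass to \<open>e(x := k)\<close>.\<close>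

lemma Delta0_decided:
  assumes "Delta0 \<phi>" and "imp_only_neg \<phi> \<or> Ex_falso \<subseteq> \<Gamma>"
  shows "if sat e \<phi> then \<Gamma> \<turnstile> subst (\<lambda>v. numl (e v)) \<phi> else \<Gamma> \<turnstile> Neg (subst (\<lambda>v. numl (e v)) \<phi>)"
  using assms
proof (induction arbitrary: e rule: Delta0.induct)
  case (1 s t)
  then show ?case by (auto simp: substt_numl QL0_numl_refl QL0_numl_neq)
next
  case (2 s t)
  then show ?case by (auto simp: substt_numl QL0_numl_le QL0_numl_not_le)
next
  case (3 s t u)
  then show ?case
    using QL0.mp[OF QL0_numl_refl QL0_Add_numl(2), of "eval e s" "eval e t"]
      QL0.trans[OF QL0_Add_numl(1) QL0_numl_neq, of "eval e s" "eval e t" "eval e u"]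
    by (cases "sat e (Add s t u)") (simp_all add: substt_numl)
next
  case (4 s t u)
  then show ?case
    using QL0.mp[OF QL0_numl_refl QL0_Mul_numl(2), of "eval e s" "eval e t"]
      QL0.trans[OF QL0_Mul_numl(1) QL0_numl_neq, of "eval e s" "eval e t" "eval e u"]
    by (cases "sat e (Mul s t u)") (simp_all add: substt_numl)
next
  case 5
  then show ?case by (simp add: QL0.ident)
next
  case (6 \<phi> \<psi>)
  let ?s = "subst (\<lambda>v. numl (e v))"
  have \<phi>: "if sat e \<phi> then \<Gamma> \<turnstile> ?s \<phi> else \<Gamma> \<turnstile> Neg (?s \<phi>)"
    using 6 by auto
  have \<psi>: "if sat e \<psi> then \<Gamma> \<turnstile> ?s \<psi> else \<Gamma> \<turnstile> Neg (?s \<psi>)"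
    using 6 by auto
  \<comment> \<open>Either the implication is a negation, and this is \<open>Imp Bot Bot\<close>, or
    it belongs to \<open>Ex_falso\<close>.\<close>
  have ex_falso: "\<Gamma> \<turnstile> Imp Bot (?s \<psi>)"
    using "6.prems" by (auto simp: Ex_falso_def intro: QL0.ident QL0.hyp)
  consider "sat e \<psi>" | "\<not> sat e \<phi>" | "sat e \<phi>" "\<not> sat e \<psi>" by blast
  then show ?case
  proof cases
    case 1
    then show ?thesis using \<psi> by (simp add: QL0.weak)
  next
    case 2
    then show ?thesis using \<phi> QL0.trans[OF _ ex_falso, of "?s \<phi>"] by simp
  next
    case 3
    \<comment> \<open>Assertion turns the derivable antecedent \<open>A\<close> into
      \<open>(A \<rightarrow> B) \<rightarrow> B\<close>, which is chained with the refutation of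
      \<open>B\<close>.\<close>
    then show ?thesis
      using \<phi> \<psi> QL0.trans[OF QL0.assertion, of \<Gamma> "?s \<phi>" "?s \<psi>" Bot] by simp
  qed
next
  case (7 \<phi> \<psi>)
  let ?s = "subst (\<lambda>v. numl (e v))"
  have "if sat e \<phi> then \<Gamma> \<turnstile> ?s \<phi> else \<Gamma> \<turnstile> Neg (?s \<phi>)"
    and "if sat e \<psi> then \<Gamma> \<turnstile> ?s \<psi> else \<Gamma> \<turnstile> Neg (?s \<psi>)"
    using 7 by auto
  then show ?case
    using QL0.trans[OF QL0.conjE1, of \<Gamma> "?s \<phi>" Bot "?s \<psi>"]
      QL0.trans[OF QL0.conjE2, of \<Gamma> "?s \<psi>" Bot "?s \<phi>"]
    by (auto simp: QL0_And split: if_splits)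
next
  case (8 \<phi> \<psi>)
  let ?s = "subst (\<lambda>v. numl (e v))"
  have "if sat e \<phi> then \<Gamma> \<turnstile> ?s \<phi> else \<Gamma> \<turnstile> Neg (?s \<phi>)"
    and "if sat e \<psi> then \<Gamma> \<turnstile> ?s \<psi> else \<Gamma> \<turnstile> Neg (?s \<psi>)"
    using 8 by auto
  then show ?case
    using QL0.mp[OF _ QL0.disjI1, of \<Gamma> "?s \<phi>" "?s \<psi>"] QL0.mp[OF _ QL0.disjI2, of \<Gamma> "?s \<psi>" "?s \<phi>"]
    by (auto simp: QL0.disjE split: if_splits)
next
  case (9 \<phi> x y)
  let ?\<psi> = "subst ((\<lambda>v. numl (e v))(x := Var x)) \<phi>"
  have \<phi>: "if sat (e(x := k)) \<phi> then \<Gamma> \<turnstile> subst1 x (numl k) ?\<psi>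
      else \<Gamma> \<turnstile> Neg (subst1 x (numl k) ?\<psi>)" for k
    unfolding subst1_subst_numl by (rule "9.IH") (use "9.prems" in auto)
  \<comment> \<open>Since \<open>x \<noteq> y\<close>, the bound \<open>y\<close> becomes a numeral
    while \<open>x\<close> remains a variable.\<close>
  have eq: "subst (\<lambda>v. numl (e v)) (AllLe x y \<phi>) = All x (Or (Neg (Le (Var x) (numl (e y)))) ?\<psi>)"
    using 9 by simp
  have iff: "sat e (AllLe x y \<phi>) \<longleftrightarrow> (\<forall>k\<le>e y. sat (e(x := k)) \<phi>)"
    using \<open>x \<noteq> y\<close> by auto
  show ?case
  proof (cases "sat e (AllLe x y \<phi>)")
    case True
    then have "sat (e(x := k)) \<phi>" if "k \<le> e y" for k
      using that unfolding iff by blast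
    then have "\<Gamma> \<turnstile> subst1 x (numl k) ?\<psi>" if "k \<le> e y" for k
      using \<phi>[of k] that by (simp only: if_True)
    then show ?thesis
      using True unfolding eq by (simp only: if_True) (intro QL0_gen QL0_bounded)
  next
    case False
    then obtain k where k: "k \<le> e y" "\<not> sat (e(x := k)) \<phi>"
      unfolding iff by blast
    have "\<Gamma> \<turnstile> Imp (All x (Or (Neg (Le (Var x) (numl (e y)))) ?\<psi>))
        (Or (Neg (Le (numl k) (numl (e y)))) (subst1 x (numl k) ?\<psi>))"
      using QL0.allE[of "numl k" x "Or (Neg (Le (Var x) (numl (e y)))) ?\<psi>" \<Gamma>]
      by (simp add: substitutable_closed)
    \<comment> \<open>At the counterexample \<open>k\<close> both disjuncts fail: the first by
      assertion from the derivable \<open>k \<le> e y\<close>, the second by the induction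
      hypothesis.\<close>
    moreover have "\<Gamma> \<turnstile> Neg (Or (Neg (Le (numl k) (numl (e y)))) (subst1 x (numl k) ?\<psi>))"
      using k \<phi>[of k] by (intro QL0.disjE QL0.assertion QL0_numl_le) (simp_all only: if_False)
    ultimately show ?thesis
      using False unfolding eq by (simp only: if_False) (rule QL0.trans)
  qed
next
  case (10 \<phi> x y)
  let ?\<psi> = "subst ((\<lambda>v. numl (e v))(x := Var x)) \<phi>"
  have \<phi>: "if sat (e(x := k)) \<phi> then \<Gamma> \<turnstile> subst (\<lambda>v. numl ((e(x := k)) v)) \<phi>
      else \<Gamma> \<turnstile> Neg (subst (\<lambda>v. numl ((e(x := k)) v)) \<phi>)" for k
    by (rule "10.IH") (use "10.prems" in auto)
  have eq: "subst (\<lambda>v. numl (e v)) (ExLe x y \<phi>) = Ex x (And (Le (Var x) (numl (e y))) ?\<psi>)"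
    using 10 by simp
  have iff: "sat e (ExLe x y \<phi>) \<longleftrightarrow> (\<exists>k\<le>e y. sat (e(x := k)) \<phi>)"
    using \<open>x \<noteq> y\<close> by auto
  show ?case
  proof (cases "sat e (ExLe x y \<phi>)")
    case True
    then obtain k where k: "k \<le> e y" "sat (e(x := k)) \<phi>"
      unfolding iff by blast
    have "\<Gamma> \<turnstile> subst (\<lambda>v. numl ((e(x := k)) v)) (And (Le (Var x) (Var y)) \<phi>)"
      using k \<phi>[of k] \<open>x \<noteq> y\<close> by (auto intro: QL0_And QL0_numl_le)
    then show ?thesis
      using True by (simp only: if_True) (rule QL0_Ex_numl)
  next
    case False
    then have "\<not> sat (e(x := k)) \<phi>" if "k \<le> e y" for k
      using that unfolding iff by blast
    then have "\<Gamma> \<turnstile> subst1 x (numl k) (Neg ?\<psi>)" if "k \<le> e y" for k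
      using \<phi>[of k] that by (simp only: if_False subst.simps subst1_subst_numl)
    \<comment> \<open>\<open>QL0_bounded\<close> for \<open>Neg ?\<psi>\<close> yields exactly the
      disjunction of negations that \<open>deMorgan\<close> requires.\<close>
    then have "\<Gamma> \<turnstile> Neg (And (Le (Var x) (numl (e y))) ?\<psi>)"
      by (intro QL0.deMorgan QL0_bounded)
    then show ?thesis
      using False unfolding eq by (simp only: if_False) (rule QL0.exE, simp_all)
  qed
qed

lemma Sigma1_complete:
  assumes "Sigma1 \<phi>" and "imp_only_neg \<phi> \<or> Ex_falso \<subseteq> \<Gamma>" and "sat e \<phi>"
  shows "\<Gamma> \<turnstile> subst (\<lambda>v. numl (e v)) \<phi>"
proof -
  obtain x \<psi> where \<phi>: "\<phi> = Ex x \<psi>" "Delta0 \<psi>"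
    using assms(1) by (auto simp: Sigma1_def)
  then obtain k where "sat (e(x := k)) \<psi>"
    using assms(3) by auto
  then have "\<Gamma> \<turnstile> subst (\<lambda>v. numl ((e(x := k)) v)) \<psi>"
    using Delta0_decided[OF \<phi>(2), of "e(x := k)"] assms(2) \<phi>(1) by auto
  then show ?thesis
    unfolding \<phi>(1) by (rule QL0_Ex_numl)
qed

end

theorem mainTheorem8:
  fixes \<phi> :: fm and xs ks :: "nat list"
  assumes "Sigma1 \<phi>"
    and "distinct xs" and "fv \<phi> \<subseteq> set xs"
    and "length ks = length xs"
  shows "(imp_only_neg \<phi> \<longrightarrow> (N_models \<phi> xs ks \<longleftrightarrow> R_sim \<turnstile> num_inst \<phi> xs ks)) \<and>
         (N_models \<phi> xs ks \<longleftrightarrow> R_sim \<union> Ex_falso \<turnstile> num_inst \<phi> xs ks)"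
proof -
  \<comment> \<open>The default \<open>0\<close> is harmless: all free variables of
    \<open>\<phi>\<close> lie in \<open>xs\<close>, so truth and numeral instance depend on
    \<open>ks\<close> alone.\<close>
  define e where "e v = (case map_of (zip xs ks) v of None \<Rightarrow> 0 | Some k \<Rightarrow> k)" for v
  have e: "map e xs = ks"
    using assms(2,4) by (intro nth_equalityI) (auto simp: e_def map_of_zip_nth)
  have "sat d \<phi> \<longleftrightarrow> sat e \<phi>" if "map d xs = ks" for d
    using that e assms(3) by (intro sat_cong) (metis map_eq_conv subsetD)
  then have models: "N_models \<phi> xs ks \<longleftrightarrow> sat e \<phi>"
    using e unfolding N_models_def by blast
  have inst: "num_inst \<phi> xs ks = subst (\<lambda>v. numl (e v)) \<phi>"
    unfolding num_inst_def
  proof (rule subst_cong)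
    fix v
    assume "v \<in> fv \<phi>"
    then obtain k where "map_of (zip xs ks) v = Some k"
      using assms(3,4) map_of_zip_is_Some[of xs ks v] by auto
    then show "(case map_of (zip xs ks) v of None \<Rightarrow> Var v | Some k \<Rightarrow> numl k) = numl (e v)"
      by (simp add: e_def)
  qed
  \<comment> \<open>Both equivalences at once, with \<open>\<Gamma>\<close> to be either
    \<open>R_sim\<close> or \<open>R_sim \<union> Ex_falso\<close>. The lower bound on
    \<open>\<Gamma>\<close> serves completeness, the upper bound soundness.\<close>
  have "N_models \<phi> xs ks \<longleftrightarrow> \<Gamma> \<turnstile> num_inst \<phi> xs ks"
    if "R_sim \<subseteq> \<Gamma>" "\<Gamma> \<subseteq> R_sim \<union> Ex_falso" "imp_only_neg \<phi> \<or> Ex_falso \<subseteq> \<Gamma>" for \<Gamma>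
  proof
    assume "N_models \<phi> xs ks"
    then show "\<Gamma> \<turnstile> num_inst \<phi> xs ks"
      using Sigma1_complete[OF that(1) assms(1) that(3)] by (simp add: models inst)
  next
    assume "\<Gamma> \<turnstile> num_inst \<phi> xs ks"
    then have "sat e (num_inst \<phi> xs ks)"
      by (rule QL0_sound) (use that(2) in \<open>auto dest: sat_R_sim sat_Ex_falso\<close>)
    then show "N_models \<phi> xs ks"
      by (simp add: models inst sat_subst_numl)
  qed
  then show ?thesis by blast
qed

end
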